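(* In the payment network creation game with $n$ players, betweenness weight $b\ge0$ and closeness weight $c>1$, the only Nash equilibrium is the complete graph; i.e., the complete graph is a Nash equilibrium, and every Nash equilibrium $s$ has $G[s]$ equal to the complete graph on $[n]$.
   Context: Payment network creation game. There are $n$ players $[n]=\{0,1,\dots,n-1\}$. A strategy of player $u$ is a set $s_u\subseteq [n]\setminus\{u\}$ (the players to whom $u$ opens a channel). A strategy combination is $s=(s_0,\dots,s_{n-1})$, and $G[s]$ is the undirected simple graph on $[n]$ in which $u,v$ are adjacent iff $v\in s_u$ or $u\in s_v$. With weights $b\ge 0$ and $c>0$, the cost of $u$ is $$\mathrm{cost}_u(s)=|s_u|+b\cdot \mathrm{betweenness}_u(s)+c\cdot \mathrm{closeness}_u(s),$$ $$\mathrm{betweenness}_u(s)=(n-1)(n-2)-\sum_{\substack{(i,j)\in[n]^2:\ i\ne j,\ i\neq u,\ j\ne u,\\ m(i,j)>0}}\frac{m_u(i,j)}{m(i,j)},\qquad \mathrm{closeness}_u(s)=\sum_{v\in[n]\setminus\{u\}}\bigl(d_{G[s]}(u,v)-1\bigr).$$ The sum in the betweenness runs over ordered pairs; $m(i,j)$ is the number of shortest paths between $i$ and $j$ in $G[s]$ and $m_u(i,j)$ the number of those passing through $u$; $d_{G[s]}$ is graph distance, equal to $\infty$ between different components. The graph is assumed connected in equilibrium (a player's cost is infinite in a disconnected graph, and disconnected strategy combinations are not regarded as equilibria). A strategy combination $s$ is a Nash equilibrium if no player can strictly decrease her cost by unilaterally changing her strategy; a graph $G$ is called a Nash equilibrium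 if $G=G[s]$ for some Nash equilibrium $s$. *)

theory Defs
  imports "Graph_Theory.Graph_Theory"
begin

type_synonym strategy_profile = "nat \<Rightarrow> nat set"

definition profiles :: "nat \<Rightarrow> strategy_profile set" where
  "profiles n = (\<Pi>\<^sub>E u\<in>{..<n}. Pow ({..<n} - {u}))"

text \<open>Undirected simple graphs are symmetric loop-free digraphs without parallel arcs
  (\<^locale>\<open>pair_graph\<close>): the edge between u and v is the pair of arcs (u,v) and (v,u).\<close>

definition channel_graph :: "nat \<Rightarrow> strategy_profile \<Rightarrow> nat pair_pre_digraph" where
  "channel_graph n s =
     \<lparr> pverts = {..<n},
       parcs = {(u, v). u < n \<and> v < n \<and> u \<noteq> v \<and> (v \<in> s u \<or> u \<in> s v)} \<rparr>"

lemma pair_graph_channel_graph: "pair_graph (channel_graph n s)"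
proof -
  have "finite (parcs (channel_graph n s))"
    by (rule finite_subset[of _ "{..<n} \<times> {..<n}"]) (auto simp: channel_graph_def)
  then show ?thesis
    by unfold_locales
      (auto simp: channel_graph_def symmetric_def intro!: symI)
qed

definition complete_graph :: "nat \<Rightarrow> nat pair_pre_digraph" where
  "complete_graph n =
     \<lparr> pverts = {..<n}, parcs = {(u, v). u < n \<and> v < n \<and> u \<noteq> v} \<rparr>"

lemma complete_digraph_complete_graph: "complete_digraph n (with_proj (complete_graph n))"
  unfolding complete_digraph_pair_def by (auto simp: complete_graph_def)

text \<open>With unit weights, \<^const>\<open>wf_digraph.\<mu>\<close> is the infimum of the lengths of the walks
  from u to v, hence infinite between different components.\<close>

definition gdist :: "nat pair_pre_digraph \<Rightarrow> nat \<Rightarrow> nat \<Rightarrow> ereal" where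
  "gdist G u v = wf_digraph.\<mu> (with_proj G) (\<lambda>_. 1) u v"

definition shortest_paths :: "nat pair_pre_digraph \<Rightarrow> nat \<Rightarrow> nat \<Rightarrow> (nat \<times> nat) list set" where
  "shortest_paths G i j =
     {p. pre_digraph.apath (with_proj G) i p j \<and> ereal (real (length p)) = gdist G i j}"

definition num_sp :: "nat pair_pre_digraph \<Rightarrow> nat \<Rightarrow> nat \<Rightarrow> nat" where
  "num_sp G i j = card (shortest_paths G i j)"

definition num_sp_through :: "nat pair_pre_digraph \<Rightarrow> nat \<Rightarrow> nat \<Rightarrow> nat \<Rightarrow> nat" where
  "num_sp_through G u i j =
     card {p \<in> shortest_paths G i j. u \<in> set (pre_digraph.awalk_verts (with_proj G) i p)}"

definition betweenness :: "nat \<Rightarrow> nat \<Rightarrow> strategy_profile \<Rightarrow> real" where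
  "betweenness n u s =
     (let G = channel_graph n s in
       (real n - 1) * (real n - 2) -
       (\<Sum>(i, j) | i < n \<and> j < n \<and> i \<noteq> j \<and> i \<noteq> u \<and> j \<noteq> u \<and> num_sp G i j > 0.
          real (num_sp_through G u i j) / real (num_sp G i j)))"

definition closeness :: "nat \<Rightarrow> nat \<Rightarrow> strategy_profile \<Rightarrow> ereal" where
  "closeness n u s = (\<Sum>v\<in>{..<n} - {u}. gdist (channel_graph n s) u v - 1)"

definition cost :: "nat \<Rightarrow> real \<Rightarrow> real \<Rightarrow> nat \<Rightarrow> strategy_profile \<Rightarrow> ereal" where
  "cost n b c u s =
     ereal (real (card (s u))) + ereal (b * betweenness n u s) + ereal c * closeness n u s"

text \<open>Connectivity is spelled out through reachability because \<^const>\<open>connected\<close> is false of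
  the graph without vertices, which occurs for n = 0. By symmetry of the channel graph, directed
  and undirected reachability agree.\<close>

definition nash_equilibrium :: "nat \<Rightarrow> real \<Rightarrow> real \<Rightarrow> strategy_profile \<Rightarrow> bool" where
  "nash_equilibrium n b c s \<longleftrightarrow>
     s \<in> profiles n \<and>
     (\<forall>u<n. \<forall>v<n. u \<rightarrow>\<^sup>*\<^bsub>with_proj (channel_graph n s)\<^esub> v) \<and>
     (\<forall>u<n. \<forall>t. t \<subseteq> {..<n} - {u} \<longrightarrow> \<not> cost n b c u (s(u := t)) < cost n b c u s)"

definition nash_graph :: "nat \<Rightarrow> real \<Rightarrow> real \<Rightarrow> nat pair_pre_digraph \<Rightarrow> bool" where
  "nash_graph n b c G \<longleftrightarrow> (\<exists>s. nash_equilibrium n b c s \<and> G = channel_graph n s)"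

end

theory Submission
  imports Defs
begin

text \<open>Opening a channel at u creates only paths through u. Such a path is either strictly shorter
  than the old ones, and then all shortest paths between its ends pass through u, or it joins the
  old shortest paths and raises the fraction passing through u. So the betweenness cost of u never
  grows, and for two non-adjacent players the closeness gain of at least c > 1 beats the price 1 of
  the channel. Conversely, in the complete graph with every edge bought by its smaller end, no
  change of strategy of u can create shortest paths through u, while every dropped channel costs at
  least c.\<close>

section \<open>Distances and shortest paths\<close>

abbreviation walk :: "nat pair_pre_digraph \<Rightarrow> nat \<Rightarrow> (nat \<times> nat) list \<Rightarrow> nat \<Rightarrow> bool" where
  "walk G \<equiv> pre_digraph.awalk (with_proj G)"

lemma walk_iff: "walk G i p j \<longleftrightarrow> i \<in> pverts G \<and> set p \<subseteq> parcs G \<and> pcas i p j"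
  by (simp add: pre_digraph.awalk_def cas_with_proj_eq)

lemma (in wf_digraph) awalk_cost_one: "awalk_cost (\<lambda>_. 1) p = real (length p)"
  by (induction p) auto

text \<open>With unit weights the cost of a walk is its length, so bounds on distances reduce to
  bounds on the length of every walk; the infimum over no walks is infinite.\<close>

lemma gdist_eq_INF:
  assumes "pair_wf_digraph G"
  shows "gdist G i j = (INF p\<in>{p. walk G i p j}. ereal (real (length p)))"
proof -
  interpret pair_wf_digraph G by fact
  show ?thesis
    by (simp add: gdist_def \<mu>_def awalk_cost_one)
qed

lemma gdist_le_length:
  assumes "pair_wf_digraph G" "walk G i p j"
  shows "gdist G i j \<le> ereal (real (length p))"
  using assms(2) by (auto simp: gdist_eq_INF[OF assms(1)] intro: INF_lower)

lemma le_gdist: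
  assumes "pair_wf_digraph G" "\<And>p. walk G i p j \<Longrightarrow> k \<le> length p"
  shows "ereal (real k) \<le> gdist G i j"
  using assms(2) by (auto simp: gdist_eq_INF[OF assms(1)] intro: INF_greatest)

lemma gdist_antimono:
  assumes "pair_wf_digraph G" "pair_wf_digraph H" "pverts G = pverts H" "parcs G \<subseteq> parcs H"
  shows "gdist H i j \<le> gdist G i j"
  unfolding gdist_eq_INF[OF assms(1)] gdist_eq_INF[OF assms(2)]
  using assms(3,4) by (intro INF_superset_mono) (auto simp: walk_iff)

lemma one_le_gdist:
  assumes "pair_wf_digraph G" "i \<noteq> j"
  shows "1 \<le> gdist G i j"
proof -
  have "1 \<le> length p" if "walk G i p j" for p
    using that assms(2) by (cases p) (auto simp: walk_iff)
  from le_gdist[OF assms(1) this] show ?thesis by (simp add: one_ereal_def)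
qed

lemma gdist_adjacent:
  assumes "pair_wf_digraph G" "(i, j) \<in> parcs G" "i \<noteq> j"
  shows "gdist G i j = 1"
proof (rule antisym)
  have "walk G i [(i, j)] j"
    using assms pair_wf_digraph.in_arcsD1 by (fastforce simp: walk_iff)
  from gdist_le_length[OF assms(1) this] show "gdist G i j \<le> 1"
    by (simp add: one_ereal_def)
qed (rule one_le_gdist[OF assms(1,3)])

lemma two_le_gdist:
  assumes "pair_wf_digraph G" "(i, j) \<notin> parcs G" "i \<noteq> j"
  shows "2 \<le> gdist G i j"
proof -
  have "2 \<le> length p" if "walk G i p j" for p
  proof (rule ccontr)
    assume "\<not> 2 \<le> length p"
    then consider "p = []" | e where "p = [e]"
      by (cases p; cases "tl p") auto
    then show False
      using that assms(2,3) by cases (auto simp: walk_iff)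
  qed
  from le_gdist[OF assms(1) this] show ?thesis by simp
qed

lemma shortest_paths_iff:
  "p \<in> shortest_paths G i j \<longleftrightarrow>
     walk G i p j \<and> distinct (pawalk_verts i p) \<and> ereal (real (length p)) = gdist G i j"
  by (auto simp: shortest_paths_def pre_digraph.apath_def awalk_verts_with_proj_eq)

lemma finite_shortest_paths:
  assumes "pair_fin_digraph G"
  shows "finite (shortest_paths G i j)"
proof -
  interpret pair_fin_digraph G by fact
  show ?thesis
    by (rule finite_subset[OF _ apaths_finite[of i j]]) (auto simp: shortest_paths_def)
qed

text \<open>In a finite digraph the infimum defining the distance between reachable vertices is
  attained, and by a path without repeated vertices.\<close>

lemma shortest_paths_nonempty:
  assumes "pair_fin_digraph G" "walk G i p j"
  shows "shortest_paths G i j \<noteq> {}"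
proof -
  interpret pair_fin_digraph G by fact
  from assms(2) have "i \<rightarrow>\<^sup>*\<^bsub>with_proj G\<^esub> j" by (rule reachable_awalkI)
  from min_cost_awalk[OF this, of "\<lambda>_. 1"] show ?thesis
    by (auto simp: shortest_paths_def gdist_def awalk_cost_one)
qed

section \<open>Fractions of shortest paths through a player\<close>

definition through_frac :: "nat pair_pre_digraph \<Rightarrow> nat \<Rightarrow> nat \<Rightarrow> nat \<Rightarrow> real" where
  "through_frac G u i j = real (num_sp_through G u i j) / real (num_sp G i j)"

lemma num_sp_through_eq:
  "num_sp_through G u i j = card {p \<in> shortest_paths G i j. u \<in> set (pawalk_verts i p)}"
  by (simp add: num_sp_through_def awalk_verts_with_proj_eq)

lemma pawalk_verts_arc:
  assumes "pcas i p j" "(x, y) \<in> set p"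
  shows "x \<in> set (pawalk_verts i p) \<and> y \<in> set (pawalk_verts i p)"
  using assms
proof (induction p arbitrary: i)
  case (Cons e p)
  have "snd e \<in> set (pawalk_verts (snd e) p)"
    using Cons.prems(1) by (cases p) auto
  then show ?case using Cons by auto
qed simp

text \<open>Both ends of every arc of a walk lie among its vertices, so a walk that misses
  \<open>u\<close> uses none of the new arcs.\<close>

lemma walk_avoiding:
  assumes "walk H i p j" "u \<notin> set (pawalk_verts i p)" "pverts G = pverts H"
    and new: "\<And>x y. (x, y) \<in> parcs H \<Longrightarrow> (x, y) \<notin> parcs G \<Longrightarrow> x = u \<or> y = u"
  shows "walk G i p j"
proof -
  have "(x, y) \<in> parcs G" if "(x, y) \<in> set p" for x y
    using pawalk_verts_arc[of i p j x y] new[of x y] that assms(1,2)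
    by (auto simp: walk_iff)
  then show ?thesis using assms(1,3) by (auto simp: walk_iff)
qed

lemma through_frac_mono:
  assumes G: "pair_fin_digraph G" and H: "pair_fin_digraph H"
    and "pverts G = pverts H" "parcs G \<subseteq> parcs H"
    and new: "\<And>x y. (x, y) \<in> parcs H \<Longrightarrow> (x, y) \<notin> parcs G \<Longrightarrow> x = u \<or> y = u"
  shows "through_frac G u i j \<le> through_frac H u i j"
proof (cases "shortest_paths G i j = {}")
  \<comment> \<open>An unreachable pair has fraction 0 in \<open>G\<close>, since division by zero
    yields 0.\<close>
  case True
  then show ?thesis by (simp add: through_frac_def num_sp_def)
next
  case False
  note wf = pair_fin_digraph.axioms(1)[OF G] pair_fin_digraph.axioms(1)[OF H]
  let ?S = "shortest_paths G i j" and ?T = "shortest_paths H i j"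
  let ?through = "\<lambda>P. {p \<in> P. u \<in> set (pawalk_verts i p)}"
  have fin: "finite ?S" "finite ?T" using G H by (auto intro: finite_shortest_paths)
  from False obtain p where p: "walk G i p j" by (auto simp: shortest_paths_iff)
  then have "walk H i p j" using assms(3,4) by (auto simp: walk_iff)
  from shortest_paths_nonempty[OF H this] have "?T \<noteq> {}" .
  have anti: "gdist H i j \<le> gdist G i j"
    using wf assms(3,4) by (rule gdist_antimono)
  \<comment> \<open>A shortest path of \<open>H\<close> missing \<open>u\<close> survives in
    \<open>G\<close>. This bounds the distance in \<open>G\<close> by that in \<open>H\<close>; with
    \<open>anti\<close> the two agree and the path is shortest in \<open>G\<close> too.\<close>
  have old: "p \<in> ?S \<and> gdist G i j = gdist H i j"
    if "p \<in> ?T" "u \<notin> set (pawalk_verts i p)" for p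
  proof -
    have w: "walk G i p j"
      using that walk_avoiding[of H i p j u G] new assms(3) by (auto simp: shortest_paths_iff)
    have "gdist G i j = gdist H i j"
      using gdist_le_length[OF wf(1) w] anti that(1) by (auto simp: shortest_paths_iff)
    with w that(1) show ?thesis by (auto simp: shortest_paths_iff)
  qed
  show ?thesis
  proof (cases "gdist G i j = gdist H i j")
    case True
    have "?S \<subseteq> ?T" using True assms(3,4) by (fastforce simp: shortest_paths_iff walk_iff)
    \<comment> \<open>\<open>R\<close> collects the newly created shortest paths. By
      \<open>old\<close> they all pass through \<open>u\<close>, so numerator and denominator grow
      by the same amount.\<close>
    define R where "R = ?T - ?S"
    have T: "?T = ?S \<union> R" "?through ?T = ?through ?S \<union> R"
      using \<open>?S \<subseteq> ?T\<close> old by (auto simp: R_def)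
    have "finite R" "?S \<inter> R = {}" "?through ?S \<inter> R = {}" "finite (?through ?S)"
      using fin by (auto simp: R_def)
    then have cards: "card ?T = card ?S + card R"
        "card (?through ?T) = card (?through ?S) + card R"
      using fin card_Un_disjoint[of ?S R] card_Un_disjoint[of "?through ?S" R]
      by (simp_all only: T(1)[symmetric] T(2)[symmetric])
    have "card (?through ?S) \<le> card ?S" using fin by (intro card_mono) auto
    moreover have "0 < card ?S" using fin False by (simp add: card_gt_0_iff)
    \<comment> \<open>Adding the same amount to numerator and denominator does not lower a fraction
      that is at most 1.\<close>
    moreover have "a / m \<le> (a + k) / (m + k)" if "a \<le> m" "0 < m" "0 \<le> k" for a m k :: real
      using that mult_right_mono[of a m k] by (simp add: divide_simps algebra_simps)
    ultimately show ?thesis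
      unfolding through_frac_def num_sp_def num_sp_through_eq cards by simp
  next
    case False
    \<comment> \<open>The distance has changed, so by \<open>old\<close> no shortest path of
      \<open>H\<close> misses \<open>u\<close>.\<close>
    then have "?through ?T = ?T" using old by blast
    then have "through_frac H u i j = 1"
      using fin \<open>?T \<noteq> {}\<close> by (simp add: through_frac_def num_sp_def num_sp_through_eq)
    moreover have "num_sp_through G u i j \<le> num_sp G i j"
      unfolding num_sp_def num_sp_through_eq using fin by (intro card_mono) auto
    ultimately show ?thesis by (auto simp: through_frac_def divide_le_eq_1)
  qed
qed

text \<open>A shortest path between adjacent players is a single arc and has no interior
  vertex.\<close>

lemma through_frac_adjacent:
  assumes "pair_wf_digraph G" "(i, j) \<in> parcs G" "i \<noteq> j" "u \<noteq> i" "u \<noteq> j"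
  shows "through_frac G u i j = 0"
proof -
  have "u \<notin> set (pawalk_verts i p)" if "p \<in> shortest_paths G i j" for p
  proof -
    have "length p = 1" and w: "walk G i p j"
      using that gdist_adjacent[OF assms(1-3)] by (auto simp: shortest_paths_iff)
    then obtain e where "p = [e]" by (auto simp: length_Suc_conv)
    with w assms(4,5) show ?thesis by (auto simp: walk_iff)
  qed
  then have "num_sp_through G u i j = 0" unfolding num_sp_through_eq by (simp add: card_eq_0_iff)
  then show ?thesis by (simp add: through_frac_def)
qed

text \<open>The restriction to num_sp > 0 can be dropped because x / 0 = 0.\<close>

lemma betweenness_eq:
  "betweenness n u s = (real n - 1) * (real n - 2) -
     (\<Sum>(i, j) | i < n \<and> j < n \<and> i \<noteq> j \<and> i \<noteq> u \<and> j \<noteq> u. through_frac (channel_graph n s) u i j)"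
proof -
  have "finite {(i, j). i < n \<and> j < n \<and> i \<noteq> j \<and> i \<noteq> u \<and> j \<noteq> u}"
    by (rule finite_subset[of _ "{..<n} \<times> {..<n}"]) auto
  then show ?thesis
    unfolding betweenness_def Let_def through_frac_def
    by (auto intro!: sum.mono_neutral_left)
qed

section \<open>Channel graphs\<close>

lemma pair_fin_digraph_channel_graph: "pair_fin_digraph (channel_graph n s)"
  using pair_graph_channel_graph[of n s]
  by (simp add: pair_graph_def pair_digraph_def)

lemma pair_wf_digraph_channel_graph: "pair_wf_digraph (channel_graph n s)"
  using pair_fin_digraph_channel_graph by (rule pair_fin_digraph.axioms(1))

lemma channel_graph_simps [simp]:
  "pverts (channel_graph n s) = {..<n}"
  "(x, y) \<in> parcs (channel_graph n s) \<longleftrightarrow> x < n \<and> y < n \<and> x \<noteq> y \<and> (y \<in> s x \<or> x \<in> s y)"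
  by (auto simp: channel_graph_def)

lemma channel_graph_eq_complete_graph:
  assumes "\<And>u v. u < n \<Longrightarrow> v < n \<Longrightarrow> u \<noteq> v \<Longrightarrow> v \<in> s u \<or> u \<in> s v"
  shows "channel_graph n s = complete_graph n"
  using assms by (auto simp: channel_graph_def complete_graph_def)

section \<open>The complete graph as an equilibrium\<close>

lemma nash_equilibrium_complete:
  fixes n :: nat
  assumes "c \<ge> 1"
  defines "s \<equiv> \<lambda>u\<in>{..<n}. {v. u < v \<and> v < n}"
  shows "nash_equilibrium n b c s" and "channel_graph n s = complete_graph n"
proof -
  have s: "s u = {v. u < v \<and> v < n}" if "u < n" for u
    using that by (simp add: s_def)
  show "channel_graph n s = complete_graph n"
    by (rule channel_graph_eq_complete_graph) (auto simp: s)
  interpret pair_wf_digraph "channel_graph n s" by (rule pair_wf_digraph_channel_graph)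
  have adj: "(u, v) \<in> parcs (channel_graph n s)" if "u < n" "v < n" "u \<noteq> v" for u v
    using that by (auto simp: s)
  show "nash_equilibrium n b c s"
    unfolding nash_equilibrium_def
  proof (intro conjI allI impI)
    show "s \<in> profiles n" by (auto simp: profiles_def s_def)
  next
    fix u v assume "u < n" "v < n"
    then have "walk (channel_graph n s) u (if u = v then [] else [(u, v)]) v"
      by (auto simp: walk_iff s)
    then show "u \<rightarrow>\<^sup>*\<^bsub>with_proj (channel_graph n s)\<^esub> v" by (rule reachable_awalkI)
  next
    fix u t assume u: "u < n" and t: "t \<subseteq> {..<n} - {u}"
    let ?H = "channel_graph n (s(u := t))"
    note wf = pair_wf_digraph_channel_graph[of n]
    \<comment> \<open>This serves both \<open>s\<close> and the deviation: channels between players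
      other than \<open>u\<close> do not depend on the strategy of \<open>u\<close>, so all these
      players stay pairwise adjacent.\<close>
    have no_through: "betweenness n u r = (real n - 1) * (real n - 2)"
      if "\<And>x y. x \<noteq> u \<Longrightarrow> r x = s x" for r
      unfolding betweenness_eq
      using that adj by (auto intro!: sum.neutral through_frac_adjacent[OF wf] simp: s)
    have "closeness n u s = 0"
      unfolding closeness_def using adj u
      by (auto intro!: sum.neutral simp: gdist_adjacent[OF wf])
    have fin: "finite t" "finite (s u)" using t u by (auto simp: s intro: finite_subset)
    \<comment> \<open>The players in \<open>s u - t\<close> are larger than \<open>u\<close> and
      open no channel to \<open>u\<close>. Dropping them therefore raises each of their distances to
      at least 2.\<close>
    have "ereal (real (card (s u - t))) = (\<Sum>v\<in>s u - t. 1)"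
      by (simp add: one_ereal_def)
    also have "\<dots> \<le> (\<Sum>v\<in>s u - t. gdist ?H u v - 1)"
    proof (rule sum_mono)
      fix v assume "v \<in> s u - t"
      then have "2 \<le> gdist ?H u v"
        using u by (intro two_le_gdist[OF wf]) (auto simp: s)
      \<comment> \<open>The distance is infinite if the deviation cuts \<open>u\<close> off from
        \<open>v\<close>.\<close>
      then show "1 \<le> gdist ?H u v - 1" by (cases "gdist ?H u v") (auto simp: one_ereal_def)
    qed
    also have "\<dots> \<le> closeness n u (s(u := t))"
      unfolding closeness_def
    proof (rule sum_mono2)
      fix v assume "v \<in> {..<n} - {u} - (s u - t)"
      then have "1 \<le> gdist ?H u v" by (intro one_le_gdist[OF wf]) auto
      then show "0 \<le> gdist ?H u v - 1" by (cases "gdist ?H u v") (auto simp: one_ereal_def)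
    qed (use u in \<open>auto simp: s\<close>)
    finally have close: "ereal (real (card (s u - t))) \<le> closeness n u (s(u := t))" .
    have "card (s u) \<le> card t + card (s u - t)"
      using fin by (intro order_trans[OF card_mono card_Un_le]) auto
    moreover have "real (card (s u - t)) \<le> c * real (card (s u - t))"
      using assms(1) mult_right_mono[of 1 c "real (card (s u - t))"] by simp
    ultimately have "real (card (s u)) \<le> real (card t) + c * real (card (s u - t))"
      by linarith
    then have "cost n b c u s \<le> ereal (real (card t)) + ereal (b * betweenness n u (s(u := t)))
        + ereal c * ereal (real (card (s u - t)))"
      by (simp add: cost_def \<open>closeness n u s = 0\<close> no_through)
    also have "\<dots> \<le> cost n b c u (s(u := t))"
      unfolding cost_def using close assms(1)
      by (intro add_mono ereal_mult_left_mono) auto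
    finally show "\<not> cost n b c u (s(u := t)) < cost n b c u s" by simp
  qed
qed

section \<open>Effect of opening one channel\<close>

text \<open>Every new arc has \<open>u\<close> as an end, so \<open>through_frac_mono\<close>
  applies to each summand, and the sum enters betweenness with a negative sign.\<close>

lemma betweenness_add_channel:
  "betweenness n u (s(u := insert v (s u))) \<le> betweenness n u s"
  unfolding betweenness_eq
  by (auto intro!: sum_mono through_frac_mono pair_fin_digraph_channel_graph split: if_splits)

text \<open>The summand of \<open>v\<close> drops from at least 1 to 0, and no other summand
  grows.\<close>

lemma closeness_add_channel:
  assumes "u < n" "v < n" "u \<noteq> v" "v \<notin> s u" "u \<notin> s v"
  shows "closeness n u (s(u := insert v (s u))) + 1 \<le> closeness n u s"
proof -
  let ?G = "channel_graph n s" and ?H = "channel_graph n (s(u := insert v (s u)))"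
  note wf = pair_wf_digraph_channel_graph[of n]
  have le: "gdist ?H u w - 1 \<le> gdist ?G u w - 1" for w
    by (intro ereal_minus_mono gdist_antimono wf) auto
  have "gdist ?H u v = 1" using assms by (intro gdist_adjacent wf) auto
  moreover have "2 \<le> gdist ?G u v" using assms by (intro two_le_gdist wf) auto
  ultimately have v: "gdist ?H u v - 1 + 1 \<le> gdist ?G u v - 1"
    by (cases "gdist ?G u v") (auto simp: one_ereal_def)
  have split: "closeness n u r =
      (gdist (channel_graph n r) u v - 1) +
      (\<Sum>w\<in>{..<n} - {u} - {v}. gdist (channel_graph n r) u w - 1)" for r
    unfolding closeness_def using assms by (intro sum.remove) auto
  have "closeness n u (s(u := insert v (s u))) + 1 =
      (gdist ?H u v - 1 + 1) + (\<Sum>w\<in>{..<n} - {u} - {v}. gdist ?H u w - 1)"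
    unfolding split by (simp only: ac_simps)
  also have "\<dots> \<le> closeness n u s"
    unfolding split using v le by (intro add_mono sum_mono)
  finally show ?thesis .
qed

section \<open>Completeness of every equilibrium\<close>

lemma closeness_nonneg: "0 \<le> closeness n u s"
  unfolding closeness_def
proof (rule sum_nonneg)
  fix v assume "v \<in> {..<n} - {u}"
  then have "1 \<le> gdist (channel_graph n s) u v"
    by (intro one_le_gdist pair_wf_digraph_channel_graph) auto
  then show "0 \<le> gdist (channel_graph n s) u v - 1"
    by (cases "gdist (channel_graph n s) u v") (auto simp: one_ereal_def)
qed

lemma closeness_finite:
  assumes "\<And>v. v < n \<Longrightarrow> u \<rightarrow>\<^sup>*\<^bsub>with_proj (channel_graph n s)\<^esub> v"
  shows "closeness n u s \<noteq> \<infinity>"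
proof -
  interpret pair_wf_digraph "channel_graph n s" by (rule pair_wf_digraph_channel_graph)
  have "gdist (channel_graph n s) u v < \<infinity>" if "v < n" for v
    using assms[OF that] \<mu>_reach_conv[of "\<lambda>_. 1" u v] by (simp add: gdist_def)
  then show ?thesis
    by (auto simp: closeness_def sum_Pinfty ereal_minus_eq_PInfty_iff)
qed

lemma nash_equilibrium_adjacent:
  assumes "b \<ge> 0" "c > 1" and nash: "nash_equilibrium n b c s"
    and uv: "u < n" "v < n" "u \<noteq> v"
  shows "v \<in> s u \<or> u \<in> s v"
proof (rule ccontr)
  assume "\<not> ?thesis"
  then have nonadj: "v \<notin> s u" "u \<notin> s v" by auto
  let ?t = "s(u := insert v (s u))"
  have su: "s u \<subseteq> {..<n} - {u}"
    using nash uv by (auto simp: nash_equilibrium_def profiles_def PiE_def Pi_def)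
  \<comment> \<open>Connectivity enters here: if closeness were infinite, both costs could be
    infinite and the deviation would not be a strict improvement.\<close>
  have "closeness n u s \<noteq> \<infinity>"
    using nash uv by (intro closeness_finite) (auto simp: nash_equilibrium_def)
  then obtain C where C: "closeness n u s = ereal C"
    using closeness_nonneg[of n u s] by (cases "closeness n u s") auto
  have le: "closeness n u ?t + 1 \<le> closeness n u s"
    using closeness_add_channel uv nonadj .
  then obtain D where D: "closeness n u ?t = ereal D"
    using closeness_nonneg[of n u ?t] C by (cases "closeness n u ?t") auto
  have "D + 1 \<le> C" using le C D by (simp add: one_ereal_def)
  then have "c * (D + 1) \<le> c * C" using assms(2) by (intro mult_left_mono) auto
  \<comment> \<open>The weighted closeness falls by at least \<open>c\<close>, strictly more than
    the price 1 of the new channel.\<close>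
  then have "c * D + 1 < c * C" using assms(2) by (simp add: algebra_simps)
  moreover have "b * betweenness n u ?t \<le> b * betweenness n u s"
    using assms(1) betweenness_add_channel by (rule mult_left_mono[rotated])
  moreover have "card (insert v (s u)) = Suc (card (s u))"
    using nonadj su by (intro card_insert_disjoint) (auto intro: finite_subset)
  ultimately have "cost n b c u ?t < cost n b c u s"
    unfolding cost_def by (simp add: C D)
  moreover have "insert v (s u) \<subseteq> {..<n} - {u}" using su uv by auto
  ultimately show False using nash uv by (auto simp: nash_equilibrium_def)
qed

theorem theorem3:
  fixes n :: nat and b c :: real
  assumes "b \<ge> 0" and "c > 1"
  shows "nash_graph n b c (complete_graph n) \<and>
    (\<forall>s. nash_equilibrium n b c s \<longrightarrow> channel_graph n s = complete_graph n)"
proof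
  from assms(2) have "c \<ge> 1" by simp
  from nash_equilibrium_complete[OF this] show "nash_graph n b c (complete_graph n)"
    unfolding nash_graph_def by metis
  show "\<forall>s. nash_equilibrium n b c s \<longrightarrow> channel_graph n s = complete_graph n"
    using nash_equilibrium_adjacent[OF assms] by (blast intro: channel_graph_eq_complete_graph)
qed

end
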